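(* Let $\rho(t,x)$, $t\ge 0$, $x\ge 0$, be a family of probability densities on $[0,\infty)$ which is a classical solution, for each $t>0$, of $$\partial_t \rho(t,x) = 2\int_0^{2x}\rho(t,y)\,\rho(t,2x-y)\,\mathrm{d}y - \rho(t,x),$$ and whose initial condition $\rho(0,\cdot)$ is a probability density on $[0,\infty)$ with mean $\mu>0$ and finite variance. Let $V(t)$ denote the variance of the probability density $\rho(t,\cdot)$. Then $V(t)$ decays exponentially in time; more specifically, for all $t\ge 0$, $$V(t)=V(0)\,e^{-t/2}.$$
   Context: The evolution equation preserves total mass and mean, so $\rho(t,\cdot)$ has mean $\mu$ for every $t$ and $V(t)=\int_0^\infty x^2\rho(t,x)\,\mathrm{d}x-\mu^2$. *)

theory Defs
  imports "HOL-Probability.Probability"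
begin

text \<open>A density on the half-line is a function \<open>real \<Rightarrow> real\<close> of which only the values on
  \<open>[0,\<infinity>)\<close> matter; those at negative arguments are never used.\<close>

definition halfline_law :: "(real \<Rightarrow> real) \<Rightarrow> real measure" where
  "halfline_law f = density lborel (\<lambda>x. ennreal (indicator {0..} x * f x))"

text \<open>Nonnegativity is required explicitly since \<^const>\<open>ennreal\<close> truncates negative values.\<close>

definition prob_density :: "(real \<Rightarrow> real) \<Rightarrow> bool" where
  "prob_density f \<longleftrightarrow>
     (\<forall>x\<ge>0. 0 \<le> f x) \<and> set_borel_measurable lborel {0..} f \<and> prob_space (halfline_law f)"

definition has_mean :: "(real \<Rightarrow> real) \<Rightarrow> real \<Rightarrow> bool" where
  "has_mean f m \<longleftrightarrow> has_bochner_integral (halfline_law f) (\<lambda>x. x) m"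

definition density_variance :: "(real \<Rightarrow> real) \<Rightarrow> real" where
  "density_variance f = prob_space.variance (halfline_law f) (\<lambda>x. x)"

text \<open>Bochner integrals of non-integrable functions are \<open>0\<close>, so \<^const>\<open>density_variance\<close> is
  meaningful only for densities satisfying the following predicate.\<close>

definition finite_variance :: "(real \<Rightarrow> real) \<Rightarrow> bool" where
  "finite_variance f \<longleftrightarrow>
     (\<exists>m. has_mean f m \<and> integrable (halfline_law f) (\<lambda>x. (x - m)\<^sup>2))"

text \<open>The equation holds at every \<open>t > 0\<close> and every \<open>x \<ge> 0\<close>, which includes convergence of the
  integral on its right-hand side. The initial value is attained pointwise: without continuity
  at \<open>t = 0\<close> the profile \<open>\<rho> 0\<close> would be unrelated to the solution at positive times.\<close>

definition classical_solution :: "(real \<Rightarrow> real \<Rightarrow> real) \<Rightarrow> bool" where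
  "classical_solution \<rho> \<longleftrightarrow>
     (\<forall>x\<ge>0. continuous_on {0..} (\<lambda>t. \<rho> t x)) \<and>
     (\<forall>t>0. \<forall>x\<ge>0.
        set_integrable lborel {0..2 * x} (\<lambda>y. \<rho> t y * \<rho> t (2 * x - y)) \<and>
        ((\<lambda>s. \<rho> s x) has_real_derivative
           2 * (LINT y:{0..2 * x}|lborel. \<rho> t y * \<rho> t (2 * x - y)) - \<rho> t x) (at t))"

end

theory Submission imports Defs begin

text \<open>The gain term of the equation at \<open>x\<close> is the density of the midpoint \<open>(Y + Z) / 2\<close>
  of two independent points drawn from the current law. Integrated against a test function
  \<open>\<phi> \<ge> 0\<close>, the equation therefore reads
  \<open>d/dt E \<phi>(X\<^sub>t) = E \<phi>((Y\<^sub>t + Z\<^sub>t) / 2) - E \<phi>(X\<^sub>t)\<close>. For \<open>\<phi> x = x\<close> the two terms on the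
  right cancel, so the mean stays \<open>\<mu>\<close>. For \<open>\<phi> x = (x - \<mu>)\<^sup>2\<close> independence makes the first term
  half of the second, so the variance satisfies \<open>V' = V / 2 - V = - V / 2\<close>.

  The work lies in justifying this computation for a solution that is only known pointwise in \<open>x\<close>.
  No integrable function of \<open>x\<close> is known to dominate \<open>\<partial>\<^sub>t \<rho>\<close>, so differentiation under the
  integral is not justified.
  Instead, at fixed \<open>x\<close> the equation is integrated in time: since \<open>d/dt (e\<^sup>t \<rho>(t, x))\<close> is \<open>e\<^sup>t\<close> times the
  gain and hence nonnegative, this gives Duhamel's formula \<open>duhamel\<close> in \<open>[0, \<infinity>]\<close>. Then
  Tonelli's theorem, which needs only joint measurability, yields the integrated moment identity
  \<open>moment_evolution\<close>, valid for every measurable \<open>\<phi> \<ge> 0\<close> even if both sides are infinite.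

  That identity alone does not exclude that a moment becomes infinite at once: for
  \<open>\<phi> x = x\<close> it is satisfied by \<open>\<infinity>\<close> at all positive times. The a priori bound \<open>moment_le\<close> excludes
  this by truncation. If \<open>\<phi>((y + z) / 2) \<le> max (\<phi> y) (\<phi> z)\<close>, the same holds for
  \<open>min \<phi> n\<close>, whose moment is bounded by \<open>n\<close> and satisfies a Gronwall inequality with constants that
  do not depend on \<open>n\<close>; then \<open>n \<rightarrow> \<infinity>\<close>. Both test functions above have this property. Once a
  moment is known to be locally bounded, its linear integral equation has the exponential as its only
  solution (\<open>moment_exponential\<close>).\<close>

section \<open>Measurability of functions continuous in one variable\<close>

text \<open>Rounding the first argument down to the grid of mesh \<open>1 / (n + 1)\<close> gives functions that are
  jointly measurable because only countably many sections occur; they converge by continuity.\<close>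

lemma caratheodory_borel_measurable:
  fixes f :: "real \<Rightarrow> real \<Rightarrow> real"
  assumes measurable_section: "\<And>s. f s \<in> borel_measurable borel"
    and continuous_section: "\<And>x. continuous_on UNIV (\<lambda>s. f s x)"
  shows "(\<lambda>p. f (fst p) (snd p)) \<in> borel_measurable (borel \<Otimes>\<^sub>M borel)"
proof (rule borel_measurable_LIMSEQ_real[where u = "\<lambda>n p.
    f (real_of_int \<lfloor>real (Suc n) * fst p\<rfloor> / real (Suc n)) (snd p)"])
  let ?grid = "\<lambda>n s. real_of_int \<lfloor>real (Suc n) * s\<rfloor> / real (Suc n)"
  fix p :: "real \<times> real"
  have "(\<lambda>n. ?grid n (fst p)) \<longlonglongrightarrow> fst p"
  proof (rule tendsto_sandwich)
    show "\<forall>\<^sub>F n in sequentially. fst p - 1 / real (Suc n) \<le> ?grid n (fst p)"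
    proof (intro always_eventually allI)
      fix n
      have "real (Suc n) * fst p - 1 \<le> real_of_int \<lfloor>real (Suc n) * fst p\<rfloor>" by linarith
      then have "(real (Suc n) * fst p - 1) / real (Suc n) \<le> ?grid n (fst p)"
        by (intro divide_right_mono) auto
      then show "fst p - 1 / real (Suc n) \<le> ?grid n (fst p)"
        by (simp add: diff_divide_distrib)
    qed
    show "\<forall>\<^sub>F n in sequentially. ?grid n (fst p) \<le> fst p"
    proof (intro always_eventually allI)
      fix n
      have "?grid n (fst p) \<le> (real (Suc n) * fst p) / real (Suc n)"
        by (intro divide_right_mono of_int_floor_le) auto
      then show "?grid n (fst p) \<le> fst p" by simp
    qed
    show "(\<lambda>n. fst p - 1 / real (Suc n)) \<longlonglongrightarrow> fst p"
      using tendsto_diff[OF tendsto_const LIMSEQ_inverse_real_of_nat, of "fst p"]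
      by (simp add: inverse_eq_divide)
  qed simp
  then show "(\<lambda>n. f (?grid n (fst p)) (snd p)) \<longlonglongrightarrow> f (fst p) (snd p)"
    by (rule continuous_on_tendsto_compose[OF continuous_section]) auto
next
  fix n
  have "(\<lambda>p. f (real_of_int k / real (Suc n)) (snd p)) \<in> borel_measurable (borel \<Otimes>\<^sub>M borel)"
    for k :: int
    using measurable_section by (rule measurable_compose[OF measurable_snd])
  moreover have "(\<lambda>p::real \<times> real. \<lfloor>real (Suc n) * fst p\<rfloor>)
      \<in> measurable (borel \<Otimes>\<^sub>M borel) (count_space UNIV)"
    by measurable
  ultimately show "(\<lambda>p. f (real_of_int \<lfloor>real (Suc n) * fst p\<rfloor> / real (Suc n)) (snd p))
      \<in> borel_measurable (borel \<Otimes>\<^sub>M borel)"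
    by (rule measurable_compose_countable
        [where f = "\<lambda>k p. f (real_of_int k / real (Suc n)) (snd p)"])
qed

section \<open>Gronwall estimates for nonnegative integrals\<close>

lemma ennreal_max: "ennreal (max a b) = max (ennreal a) (ennreal b)"
  by (rule max_of_mono[symmetric]) (auto intro: monoI ennreal_leI)

lemma nn_integral_exp_le:
  fixes k t :: real
  assumes "k > 0" "t \<ge> 0"
  shows "(\<integral>\<^sup>+s\<in>{0..t}. ennreal (exp (k * s)) \<partial>lborel) \<le> ennreal (exp (k * t) / k)"
proof -
  have "(\<integral>\<^sup>+s\<in>{0..t}. ennreal (exp (k * s)) \<partial>lborel) = ennreal (exp (k * t) / k - exp (k * 0) / k)"
    using assms
    by (intro nn_integral_FTC_Icc) (auto intro!: derivative_eq_intros)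
  then show ?thesis using assms by (auto intro!: ennreal_leI)
qed

text \<open>The supremum \<open>S\<close> of \<open>g t * e\<^bsup>-2ct\<^esup>\<close> is finite, and the inequality yields \<open>S \<le> a + S / 2\<close>,
  so \<open>S \<le> 2a\<close>. The weight \<open>e\<^bsup>-2ct\<^esup>\<close> decays fast enough to turn \<open>c\<close> times the integral into a
  contraction by \<open>1 / 2\<close>. The price is a constant that is not optimal, which is harmless because
  the bound serves only to show that moments are finite.\<close>

lemma gronwall_nn_integral:
  fixes g :: "real \<Rightarrow> ennreal"
  assumes c: "c > 0" and T: "T \<ge> 0"
    and bounded: "\<And>t. t \<in> {0..T} \<Longrightarrow> g t \<le> B" and B: "B < \<infinity>"
    and ineq: "\<And>t. t \<in> {0..T} \<Longrightarrow> g t \<le> a + ennreal c * (\<integral>\<^sup>+s\<in>{0..t}. g s \<partial>lborel)"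
  shows "g T \<le> 2 * a * ennreal (exp (2 * c * T))"
proof -
  define S where "S = (SUP t\<in>{0..T}. g t * ennreal (exp (- 2 * c * t)))"
  have "S \<le> B"
    unfolding S_def
  proof (rule SUP_least)
    fix t assume t: "t \<in> {0..T}"
    have "g t * ennreal (exp (- 2 * c * t)) \<le> B * 1"
      using c t bounded[OF t] by (intro mult_mono) auto
    then show "g t * ennreal (exp (- 2 * c * t)) \<le> B" by simp
  qed
  then have fin: "S < \<infinity>" using B by (auto intro: le_less_trans)
  have cancel: "ennreal (exp (- 2 * c * t)) * ennreal (exp (2 * c * t)) = 1" for t
    by (simp add: ennreal_mult[symmetric] exp_add[symmetric] flip: ennreal_1)
  have g_le: "g t \<le> S * ennreal (exp (2 * c * t))" if t: "t \<in> {0..T}" for t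
  proof -
    have "g t = g t * ennreal (exp (- 2 * c * t)) * ennreal (exp (2 * c * t))"
      using cancel[of t] by (simp add: mult.assoc)
    also have "\<dots> \<le> S * ennreal (exp (2 * c * t))"
      unfolding S_def using t by (intro mult_right_mono SUP_upper) auto
    finally show ?thesis .
  qed
  have "S \<le> a + S * ennreal (1 / 2)"
    unfolding S_def
  proof (rule SUP_least, fold S_def)
    fix t assume t: "t \<in> {0..T}"
    have "(\<integral>\<^sup>+s\<in>{0..t}. g s \<partial>lborel)
            \<le> (\<integral>\<^sup>+s. S * (ennreal (exp (2 * c * s)) * indicator {0..t} s) \<partial>lborel)"
      using t g_le by (intro nn_integral_mono) (auto simp: indicator_def)
    also have "\<dots> = S * (\<integral>\<^sup>+s\<in>{0..t}. ennreal (exp (2 * c * s)) \<partial>lborel)"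
      by (rule nn_integral_cmult) measurable
    also have "\<dots> \<le> S * ennreal (exp (2 * c * t) / (2 * c))"
      using c t nn_integral_exp_le[of "2 * c" t] by (intro mult_left_mono) auto
    finally have int: "(\<integral>\<^sup>+s\<in>{0..t}. g s \<partial>lborel) \<le> S * ennreal (exp (2 * c * t) / (2 * c))" .
    have "g t \<le> a + ennreal c * (S * ennreal (exp (2 * c * t) / (2 * c)))"
      using ineq[OF t] int by (meson add_left_mono mult_left_mono order_trans zero_le)
    also have "ennreal c * (S * ennreal (exp (2 * c * t) / (2 * c)))
                 = S * (ennreal c * ennreal (exp (2 * c * t) / (2 * c)))"
      by (simp add: ac_simps)
    also have "ennreal c * ennreal (exp (2 * c * t) / (2 * c)) = ennreal (1 / 2) * ennreal (exp (2 * c * t))"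
      using c by (simp only: ennreal_mult''[symmetric] zero_le_divide_iff exp_ge_zero) (simp flip: ennreal_mult'')
    finally have "g t * ennreal (exp (- 2 * c * t))
        \<le> (a + S * (ennreal (1 / 2) * ennreal (exp (2 * c * t)))) * ennreal (exp (- 2 * c * t))"
      by (intro mult_right_mono) auto
    also have "\<dots> = a * ennreal (exp (- 2 * c * t))
                  + S * ennreal (1 / 2) * (ennreal (exp (- 2 * c * t)) * ennreal (exp (2 * c * t)))"
      by (simp only: distrib_left distrib_right ac_simps)
    also have "\<dots> \<le> a * 1 + S * ennreal (1 / 2) * 1"
      unfolding cancel using c t by (intro add_mono mult_left_mono) auto
    finally show "g t * ennreal (exp (- 2 * c * t)) \<le> a + S * ennreal (1 / 2)" by simp
  qed
  \<comment> \<open>Absorbing \<open>S / 2\<close> on the left is legitimate only because \<open>S\<close> is finite.\<close>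
  have "S \<le> 2 * a"
  proof (cases a)
    case (real u)
    obtain v where v: "S = ennreal v" "v \<ge> 0" using fin by (cases S) auto
    have "ennreal u + ennreal v * ennreal (1 / 2) = ennreal (u + v * (1 / 2))"
      using real v by (simp add: ennreal_mult''[of "1/2" v, symmetric] mult.commute del: ennreal_half)
    then have "ennreal v \<le> ennreal (u + v * (1 / 2))"
      using \<open>S \<le> a + S * ennreal (1 / 2)\<close> real v by metis
    then have "v \<le> 2 * u" using real by (subst (asm) ennreal_le_iff) (use v in auto)
    then have "ennreal v \<le> ennreal (2 * u)" by (rule ennreal_leI)
    then show ?thesis using real v by (simp add: ennreal_mult)
  qed (simp add: ennreal_mult_top)
  have "g T \<le> S * ennreal (exp (2 * c * T))" using T by (intro g_le) auto
  also have "\<dots> \<le> 2 * a * ennreal (exp (2 * c * T))" using \<open>S \<le> 2 * a\<close> by (intro mult_right_mono) auto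
  finally show ?thesis .
qed

text \<open>A bounded solution is an indefinite integral, hence continuous, hence differentiable with
  \<open>g' = c g\<close>. Boundedness cannot be dropped: the function that is \<open>\<infinity>\<close> on \<open>(0, T]\<close> is
  a solution for every value at \<open>0\<close>.\<close>

lemma linear_integral_equation:
  fixes g :: "real \<Rightarrow> ennreal"
  assumes g[measurable]: "g \<in> borel_measurable borel"
    and c: "c > 0" and T: "T \<ge> 0" and B: "B < \<infinity>"
    and bounded: "\<And>t. t \<in> {0..T} \<Longrightarrow> g t \<le> B"
    and eq: "\<And>t. t \<in> {0..T} \<Longrightarrow> g t = g 0 + ennreal c * (\<integral>\<^sup>+s\<in>{0..t}. g s \<partial>lborel)"
  shows "g T = g 0 * ennreal (exp (c * T))"
proof -
  define h where "h = (\<lambda>t. enn2real (g t))"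
  have gh: "g t = ennreal (h t)" if "t \<in> {0..T}" for t
    using le_less_trans[OF bounded[OF that] B] by (simp add: h_def)
  have h0: "h t \<ge> 0" for t by (simp add: h_def)
  have [measurable]: "h \<in> borel_measurable borel" by (simp add: h_def)
  have h_B: "h t \<le> enn2real B" if "t \<in> {0..T}" for t
    using bounded[OF that] B by (auto simp: h_def intro!: enn2real_mono)
  have int: "set_integrable lborel {0..T} h"
    unfolding set_integrable_def
  proof (rule integrableI_bounded_set_indicator[where B="enn2real B"])
    show "AE x in lborel. x \<in> {0..T} \<longrightarrow> norm (h x) \<le> enn2real B" using h_B h0 by auto
  qed (use T in auto)
  have int': "set_integrable lborel {0..t} h" if "t \<in> {0..T}" for t
    by (rule set_integrable_subset[OF int]) (use that in auto)
  have "h integrable_on {0..T}" using int by (rule set_borel_integral_eq_integral)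
  have h_eq: "h t = h 0 + c * integral {0..t} h" if t: "t \<in> {0..T}" for t
  proof -
    have "(\<integral>\<^sup>+s\<in>{0..t}. g s \<partial>lborel) = (\<integral>\<^sup>+s. ennreal (indicator {0..t} s *\<^sub>R h s) \<partial>lborel)"
      using t by (intro nn_integral_cong) (auto simp: indicator_def gh)
    also have "\<dots> = ennreal (LINT s:{0..t}|lborel. h s)"
      unfolding set_lebesgue_integral_def
      using int'[OF t] h0 by (intro nn_integral_eq_integral) (auto simp: set_integrable_def)
    also have "(LINT s:{0..t}|lborel. h s) = integral {0..t} h"
      using int'[OF t] by (rule set_borel_integral_eq_integral)
    finally have "ennreal (h t) = ennreal (h 0) + ennreal c * ennreal (integral {0..t} h)"
      using eq[OF t] gh[OF t] gh[of 0] T by auto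
    moreover have "integral {0..t} h \<ge> 0"
      using h0 by (intro integral_nonneg set_borel_integral_eq_integral(1)[OF int'[OF t]])
    ultimately show ?thesis
      using h0[of 0] h0[of t] c by (simp flip: ennreal_mult ennreal_plus)
  qed
  have "continuous_on {0..T} (\<lambda>t. h 0 + c * integral {0..t} h)"
    by (intro continuous_intros indefinite_integral_continuous_1 \<open>h integrable_on {0..T}\<close>)
  then have cont: "continuous_on {0..T} h"
    by (subst continuous_on_cong[OF refl h_eq]) auto
  have "((\<lambda>t. h t * exp (- c * t)) has_real_derivative 0) (at t within {0..T})" if t: "t \<in> {0..T}" for t
  proof -
    have "((\<lambda>t. h 0 + c * integral {0..t} h) has_real_derivative c * h t) (at t within {0..T})"
      by (auto intro!: derivative_eq_intros integral_has_real_derivative[OF cont t])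
    then have "(h has_real_derivative c * h t) (at t within {0..T})"
      by (rule has_field_derivative_transform_within[where d=1]) (use t in \<open>auto intro: h_eq[symmetric]\<close>)
    then show ?thesis by (auto intro!: derivative_eq_intros simp: algebra_simps)
  qed
  then obtain k where "\<And>t. t \<in> {0..T} \<Longrightarrow> h t * exp (- c * t) = k"
    using has_field_derivative_zero_constant[of "{0..T}" "\<lambda>t. h t * exp (- c * t)"] by auto
  from this[of T] this[of 0] T have "h T * exp (- c * T) = h 0" by simp
  then have "h T = h 0 * exp (c * T)" by (simp add: exp_minus field_simps)
  then show ?thesis using gh[of T] gh[of 0] T h0[of 0] by (simp add: ennreal_mult)
qed

section \<open>The flow of midpoint averages\<close>

text \<open>The inner integral on the left is the density of \<open>(Y + Z) / 2\<close> at \<open>x\<close>. The substitution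
  \<open>x = (y + z) / 2\<close>, with \<open>dx = dz / 2\<close>, accounts for the factor \<open>2\<close>.\<close>

lemma nn_integral_midpoint_convolution:
  fixes f :: "real \<Rightarrow> real" and \<phi> :: "real \<Rightarrow> ennreal"
  assumes f[measurable]: "f \<in> borel_measurable borel" and nonneg: "\<And>x. 0 \<le> f x"
    and \<phi>[measurable]: "\<phi> \<in> borel_measurable borel"
  defines "M \<equiv> density lborel (\<lambda>x. ennreal (f x))"
  shows "(\<integral>\<^sup>+x. (\<integral>\<^sup>+y. ennreal (2 * (f y * f (2 * x - y))) \<partial>lborel) * \<phi> x \<partial>lborel)
           = (\<integral>\<^sup>+y. \<integral>\<^sup>+z. \<phi> ((y + z) / 2) \<partial>M \<partial>M)"
proof -
  have "(\<integral>\<^sup>+x. (\<integral>\<^sup>+y. ennreal (2 * (f y * f (2 * x - y))) \<partial>lborel) * \<phi> x \<partial>lborel)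
      = (\<integral>\<^sup>+x. \<integral>\<^sup>+y. ennreal (2 * (f y * f (2 * x - y))) * \<phi> x \<partial>lborel \<partial>lborel)"
    by (intro nn_integral_cong nn_integral_multc[symmetric]) measurable
  also have "\<dots> = (\<integral>\<^sup>+y. \<integral>\<^sup>+x. ennreal (2 * (f y * f (2 * x - y))) * \<phi> x \<partial>lborel \<partial>lborel)"
    by (rule lborel_pair.Fubini') measurable
  also have "\<dots> = (\<integral>\<^sup>+y. ennreal (f y) * (\<integral>\<^sup>+z. ennreal (f z) * \<phi> ((y + z) / 2) \<partial>lborel) \<partial>lborel)"
  proof (rule nn_integral_cong)
    fix y
    have "(\<integral>\<^sup>+x. ennreal (2 * (f y * f (2 * x - y))) * \<phi> x \<partial>lborel)
        = ennreal (1 / 2) *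
          (\<integral>\<^sup>+z. ennreal (2 * (f y * f (2 * (y / 2 + 1 / 2 * z) - y))) * \<phi> (y / 2 + 1 / 2 * z) \<partial>lborel)"
      by (subst nn_integral_real_affine[where c = "1 / 2" and t = "y / 2"]) auto
    also have "\<dots> = (\<integral>\<^sup>+z. ennreal (1 / 2) *
          (ennreal (2 * (f y * f (2 * (y / 2 + 1 / 2 * z) - y))) * \<phi> (y / 2 + 1 / 2 * z)) \<partial>lborel)"
      by (rule nn_integral_cmult[symmetric]) measurable
    also have "\<dots> = (\<integral>\<^sup>+z. ennreal (f y) * (ennreal (f z) * \<phi> ((y + z) / 2)) \<partial>lborel)"
    proof (rule nn_integral_cong)
      fix z
      have "ennreal (1 / 2) * (ennreal (2 * (f y * f z)) * \<phi> ((y + z) / 2))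
          = ennreal (1 / 2 * (2 * (f y * f z))) * \<phi> ((y + z) / 2)"
        by (subst ennreal_mult'') (use nonneg in \<open>auto simp: mult.assoc\<close>)
      also have "1 / 2 * (2 * (f y * f z)) = f y * f z" by simp
      also have "ennreal (f y * f z) * \<phi> ((y + z) / 2) = ennreal (f y) * (ennreal (f z) * \<phi> ((y + z) / 2))"
        using nonneg by (simp add: ennreal_mult mult.assoc)
      finally show "ennreal (1 / 2) *
          (ennreal (2 * (f y * f (2 * (y / 2 + 1 / 2 * z) - y))) * \<phi> (y / 2 + 1 / 2 * z))
          = ennreal (f y) * (ennreal (f z) * \<phi> ((y + z) / 2))"
        by (simp add: add_divide_distrib)
    qed
    also have "\<dots> = ennreal (f y) * (\<integral>\<^sup>+z. ennreal (f z) * \<phi> ((y + z) / 2) \<partial>lborel)"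
      by (rule nn_integral_cmult) measurable
    finally show "(\<integral>\<^sup>+x. ennreal (2 * (f y * f (2 * x - y))) * \<phi> x \<partial>lborel)
        = ennreal (f y) * (\<integral>\<^sup>+z. ennreal (f z) * \<phi> ((y + z) / 2) \<partial>lborel)" .
  qed
  also have "\<dots> = (\<integral>\<^sup>+y. \<integral>\<^sup>+z. \<phi> ((y + z) / 2) \<partial>M \<partial>M)"
    unfolding M_def by (simp add: nn_integral_density)
  finally show ?thesis .
qed

text \<open>The equation on the whole real line: profiles extended by \<open>0\<close> to negative \<open>x\<close> make the
  integral over \<open>[0, 2x]\<close> a convolution over all of \<open>\<real>\<close>. Times \<open>s < 0\<close> are included so that
  measurability can be stated without restricting domains; only \<open>s > 0\<close> is subject to the equation.
  The number \<open>q\<close> expresses that the gain integral converges.\<close>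

locale averaging_flow =
  fixes r :: "real \<Rightarrow> real \<Rightarrow> real"
  assumes nonneg: "0 \<le> r s x"
    and supported: "x < 0 \<Longrightarrow> r s x = 0"
    and measurable_profile: "r s \<in> borel_measurable borel"
    and mass: "(\<integral>\<^sup>+x. ennreal (r s x) \<partial>lborel) = 1"
    and continuous_in_time: "continuous_on UNIV (\<lambda>s. r s x)"
    and evolution: "0 < s \<Longrightarrow> 0 \<le> x \<Longrightarrow> \<exists>q\<ge>0.
      (\<integral>\<^sup>+y. ennreal (2 * (r s y * r s (2 * x - y))) \<partial>lborel) = ennreal q \<and>
      ((\<lambda>s. r s x) has_real_derivative q - r s x) (at s)"
begin

definition gain :: "real \<Rightarrow> real \<Rightarrow> ennreal" where
  "gain s x = (\<integral>\<^sup>+y. ennreal (2 * (r s y * r s (2 * x - y))) \<partial>lborel)"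

definition law :: "real \<Rightarrow> real measure" where
  "law s = density lborel (\<lambda>x. ennreal (r s x))"

lemma sets_law[measurable_cong, simp]: "sets (law s) = sets borel"
  by (simp add: law_def)

lemma space_law[simp]: "space (law s) = UNIV"
  by (simp add: law_def)

lemma measurable_r[measurable (raw)]:
  assumes [measurable]: "f \<in> borel_measurable M" "g \<in> borel_measurable M"
  shows "(\<lambda>x. r (f x) (g x)) \<in> borel_measurable M"
proof -
  note [measurable] = caratheodory_borel_measurable[of r, OF measurable_profile continuous_in_time]
  have "(\<lambda>x. (\<lambda>p. r (fst p) (snd p)) (f x, g x)) \<in> borel_measurable M" by measurable
  then show ?thesis by simp
qed

lemma measurable_gain[measurable (raw)]:
  assumes [measurable]: "f \<in> borel_measurable M" "g \<in> borel_measurable M"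
  shows "(\<lambda>x. gain (f x) (g x)) \<in> borel_measurable M"
  unfolding gain_def by measurable

lemma prob_space_law: "prob_space (law s)"
proof
  have "emeasure (law s) (space (law s)) = (\<integral>\<^sup>+x. ennreal (r s x) \<partial>lborel)"
    by (simp add: law_def emeasure_density)
  then show "emeasure (law s) (space (law s)) = 1" by (simp add: mass)
qed

lemma nn_integral_law:
  "\<phi> \<in> borel_measurable borel \<Longrightarrow> (\<integral>\<^sup>+x. \<phi> x \<partial>law s) = (\<integral>\<^sup>+x. ennreal (r s x) * \<phi> x \<partial>lborel)"
  unfolding law_def by (rule nn_integral_density) auto

lemma AE_law_nonneg: "AE x in law s. 0 \<le> x"
  unfolding law_def
  by (subst AE_density) (auto intro!: AE_I2 intro: leI simp: supported measurable_profile)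

lemma measurable_moment[measurable]:
  assumes [measurable]: "\<phi> \<in> borel_measurable borel"
  shows "(\<lambda>s. \<integral>\<^sup>+x. \<phi> x \<partial>law s) \<in> borel_measurable borel"
  by (simp add: nn_integral_law)

lemma moment_le_of_bounded:
  assumes "\<And>x. \<phi> x \<le> B"
  shows "(\<integral>\<^sup>+x. \<phi> x \<partial>law s) \<le> B"
proof -
  interpret prob_space "law s" by (rule prob_space_law)
  have "(\<integral>\<^sup>+x. \<phi> x \<partial>law s) \<le> (\<integral>\<^sup>+x. B \<partial>law s)" using assms by (intro nn_integral_mono)
  also have "\<dots> = B" using emeasure_space_1 by simp
  finally show ?thesis .
qed

lemma gain_negative: "x < 0 \<Longrightarrow> gain s x = 0"
proof -
  assume "x < 0"
  then have "r s y * r s (2 * x - y) = 0" for y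
    by (cases "y < 0") (auto intro: supported)
  then show ?thesis unfolding gain_def by (simp only: mult_zero_right ennreal_0 nn_integral_const mult_zero_left)
qed

text \<open>Writing the equation as \<open>d/ds (e\<^sup>s r(s, x)) = e\<^sup>s gain(s, x)\<close> removes the loss term. The
  derivative is nonnegative, so its integral exists without any domination hypothesis.\<close>

lemma duhamel:
  assumes t: "t \<ge> 0"
  shows "ennreal (exp t) * ennreal (r t x)
           = ennreal (r 0 x) + (\<integral>\<^sup>+s\<in>{0..t}. ennreal (exp s) * gain s x \<partial>lborel)"
proof (cases "x < 0")
  case True
  then show ?thesis by (simp add: supported gain_negative)
next
  case False
  define q where "q = (\<lambda>s. enn2real (gain s x))"
  have q: "gain s x = ennreal (q s) \<and> ((\<lambda>s. r s x) has_real_derivative q s - r s x) (at s)"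
    if "s > 0" for s
    using evolution[OF that, of x] False by (auto simp: q_def gain_def)
  have q0: "q s \<ge> 0" for s by (simp add: q_def)
  \<comment> \<open>At \<open>s = 0\<close> there is only continuity and the gain may be infinite, so the version of the
      fundamental theorem for derivatives in the open interval is used and \<open>s = 0\<close> is dropped as a null set.\<close>
  have "((\<lambda>s. exp s * q s) has_integral (exp t * r t x - exp 0 * r 0 x)) {0..t}"
  proof (rule fundamental_theorem_of_calculus_interior[OF t])
    show "continuous_on {0..t} (\<lambda>s. exp s * r s x)"
      by (intro continuous_intros continuous_on_subset[OF continuous_in_time]) auto
    fix s assume "s \<in> {0<..<t}"
    then have D: "((\<lambda>s. r s x) has_real_derivative q s - r s x) (at s)" using q by simp
    have "((\<lambda>s. exp s * r s x) has_real_derivative exp s * q s) (at s)"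
      by (rule derivative_eq_intros D refl)+ (simp add: algebra_simps)
    then show "((\<lambda>s. exp s * r s x) has_vector_derivative exp s * q s) (at s)"
      by (simp add: has_real_derivative_iff_has_vector_derivative)
  qed
  then have int: "(\<integral>\<^sup>+s. ennreal (indicator {0..t} s * (exp s * q s)) \<partial>lborel)
      = ennreal (exp t * r t x - r 0 x)" and le: "r 0 x \<le> exp t * r t x"
    using q0 by (auto dest: nn_integral_has_integral_lebesgue[rotated] has_integral_nonneg)
  have "(\<integral>\<^sup>+s\<in>{0..t}. ennreal (exp s) * gain s x \<partial>lborel)
      = (\<integral>\<^sup>+s. ennreal (indicator {0..t} s * (exp s * q s)) \<partial>lborel)"
  proof (rule nn_integral_cong_AE)
    show "AE s in lborel. ennreal (exp s) * gain s x * indicator {0..t} s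
        = ennreal (indicator {0..t} s * (exp s * q s))"
      using AE_lborel_singleton[of 0]
    proof eventually_elim
      case (elim s)
      then show ?case
        using q[of s] q0[of s] by (auto simp: indicator_def ennreal_mult)
    qed
  qed
  then have "ennreal (r 0 x) + (\<integral>\<^sup>+s\<in>{0..t}. ennreal (exp s) * gain s x \<partial>lborel)
      = ennreal (r 0 x + (exp t * r t x - r 0 x))"
    unfolding int using le nonneg by (subst ennreal_plus) auto
  then show ?thesis using nonneg by (simp add: ennreal_mult)
qed

text \<open>Duhamel's formula integrated against \<open>\<phi>\<close>, with the order of integration exchanged by Tonelli.\<close>

lemma moment_evolution:
  assumes t: "t \<ge> 0" and \<phi>[measurable]: "\<phi> \<in> borel_measurable borel"
  shows "ennreal (exp t) * (\<integral>\<^sup>+x. \<phi> x \<partial>law t) = (\<integral>\<^sup>+x. \<phi> x \<partial>law 0) +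
           (\<integral>\<^sup>+s\<in>{0..t}. ennreal (exp s) * (\<integral>\<^sup>+y. \<integral>\<^sup>+z. \<phi> ((y + z) / 2) \<partial>law s \<partial>law s) \<partial>lborel)"
proof -
  have "ennreal (exp t) * (\<integral>\<^sup>+x. \<phi> x \<partial>law t)
      = (\<integral>\<^sup>+x. ennreal (exp t) * ennreal (r t x) * \<phi> x \<partial>lborel)"
    by (simp add: nn_integral_law nn_integral_cmult mult.assoc)
  also have "\<dots> = (\<integral>\<^sup>+x. ennreal (r 0 x) * \<phi> x +
      (\<integral>\<^sup>+s\<in>{0..t}. ennreal (exp s) * gain s x \<partial>lborel) * \<phi> x \<partial>lborel)"
    by (simp add: duhamel[OF t] distrib_right)
  also have "\<dots> = (\<integral>\<^sup>+x. \<phi> x \<partial>law 0) +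
      (\<integral>\<^sup>+x. (\<integral>\<^sup>+s\<in>{0..t}. ennreal (exp s) * gain s x \<partial>lborel) * \<phi> x \<partial>lborel)"
    by (subst nn_integral_add) (auto simp: nn_integral_law)
  also have "(\<integral>\<^sup>+x. (\<integral>\<^sup>+s\<in>{0..t}. ennreal (exp s) * gain s x \<partial>lborel) * \<phi> x \<partial>lborel)
      = (\<integral>\<^sup>+x. \<integral>\<^sup>+s. ennreal (exp s) * indicator {0..t} s * (gain s x * \<phi> x) \<partial>lborel \<partial>lborel)"
    by (intro nn_integral_cong) (subst nn_integral_multc[symmetric], auto simp: ac_simps)
  also have "\<dots> = (\<integral>\<^sup>+s. \<integral>\<^sup>+x. ennreal (exp s) * indicator {0..t} s * (gain s x * \<phi> x) \<partial>lborel \<partial>lborel)"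
    by (rule lborel_pair.Fubini') measurable
  also have "\<dots> = (\<integral>\<^sup>+s\<in>{0..t}. ennreal (exp s) * (\<integral>\<^sup>+x. gain s x * \<phi> x \<partial>lborel) \<partial>lborel)"
  proof (rule nn_integral_cong)
    fix s
    have "(\<integral>\<^sup>+x. ennreal (exp s) * indicator {0..t} s * (gain s x * \<phi> x) \<partial>lborel)
        = ennreal (exp s) * indicator {0..t} s * (\<integral>\<^sup>+x. gain s x * \<phi> x \<partial>lborel)"
      by (rule nn_integral_cmult) measurable
    then show "(\<integral>\<^sup>+x. ennreal (exp s) * indicator {0..t} s * (gain s x * \<phi> x) \<partial>lborel)
        = ennreal (exp s) * (\<integral>\<^sup>+x. gain s x * \<phi> x \<partial>lborel) * indicator {0..t} s"
      by (simp add: ac_simps)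
  qed
  also have "(\<lambda>s. \<integral>\<^sup>+x. gain s x * \<phi> x \<partial>lborel)
      = (\<lambda>s. \<integral>\<^sup>+y. \<integral>\<^sup>+z. \<phi> ((y + z) / 2) \<partial>law s \<partial>law s)"
    unfolding gain_def law_def
    by (intro ext nn_integral_midpoint_convolution measurable_profile nonneg \<phi>)
  finally show ?thesis .
qed

section \<open>Propagation of moments\<close>

text \<open>The midpoint condition makes \<open>\<phi>((y + z) / 2) \<le> \<phi> y + \<phi> z\<close>, so the gain contributes at most
  twice the current moment. It is stated with \<open>max\<close> because in that form, unlike for convexity, it
  is inherited by the truncations \<open>min \<phi> n\<close>. These have bounded moments, as Gronwall's
  inequality requires, and the resulting bound is independent of \<open>n\<close>.\<close>

lemma moment_le:
  assumes \<phi>[measurable]: "\<phi> \<in> borel_measurable borel"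
    and midpoint: "\<And>y z. \<phi> ((y + z) / 2) \<le> max (\<phi> y) (\<phi> z)"
    and t: "t \<ge> 0"
  shows "(\<integral>\<^sup>+x. \<phi> x \<partial>law t) \<le> 2 * (\<integral>\<^sup>+x. \<phi> x \<partial>law 0) * ennreal (exp (4 * t))"
proof -
  define \<psi> where "\<psi> = (\<lambda>n::nat. \<lambda>x. min (\<phi> x) (of_nat n))"
  have [measurable]: "\<psi> n \<in> borel_measurable borel" for n by (simp add: \<psi>_def)
  have truncated: "(\<integral>\<^sup>+x. \<psi> n x \<partial>law t) \<le> 2 * (\<integral>\<^sup>+x. \<phi> x \<partial>law 0) * ennreal (exp (4 * t))" for n
  proof -
    define A where "A = (\<lambda>s. \<integral>\<^sup>+x. \<psi> n x \<partial>law s)"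
    have [measurable]: "A \<in> borel_measurable borel" by (simp add: A_def)
    have A_le: "A s \<le> of_nat n" for s
      unfolding A_def by (rule moment_le_of_bounded) (simp add: \<psi>_def)
    have pair_le: "(\<integral>\<^sup>+y. \<integral>\<^sup>+z. \<psi> n ((y + z) / 2) \<partial>law s \<partial>law s) \<le> 2 * A s" for s
    proof -
      interpret prob_space "law s" by (rule prob_space_law)
      have "\<psi> n ((y + z) / 2) \<le> \<psi> n y + \<psi> n z" for y z
      proof -
        have "\<psi> n ((y + z) / 2) \<le> max (\<psi> n y) (\<psi> n z)"
          using midpoint[of y z] by (auto simp: \<psi>_def min_def max_def split: if_splits)
        also have "\<dots> \<le> \<psi> n y + \<psi> n z" by (simp add: add_increasing add_increasing2)
        finally show ?thesis .
      qed
      then have "(\<integral>\<^sup>+y. \<integral>\<^sup>+z. \<psi> n ((y + z) / 2) \<partial>law s \<partial>law s)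
          \<le> (\<integral>\<^sup>+y. \<integral>\<^sup>+z. \<psi> n y + \<psi> n z \<partial>law s \<partial>law s)"
        by (intro nn_integral_mono)
      also have "\<dots> = 2 * A s"
        using emeasure_space_1 by (simp add: nn_integral_add A_def mult_2)
      finally show ?thesis .
    qed
    have "ennreal (exp t) * A t \<le> 2 * (ennreal (exp 0) * A 0) * ennreal (exp (2 * 2 * t))"
    proof (rule gronwall_nn_integral[where g = "\<lambda>s. ennreal (exp s) * A s" and c = 2 and T = t
          and B = "ennreal (exp t) * of_nat n"])
      fix s assume s: "s \<in> {0..t}"
      show "ennreal (exp s) * A s \<le> ennreal (exp t) * of_nat n"
        using s A_le by (intro mult_mono ennreal_leI) auto
      have "ennreal (exp s) * A s = A 0 + (\<integral>\<^sup>+u\<in>{0..s}. ennreal (exp u) *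
          (\<integral>\<^sup>+y. \<integral>\<^sup>+z. \<psi> n ((y + z) / 2) \<partial>law u \<partial>law u) \<partial>lborel)"
        unfolding A_def using s by (intro moment_evolution) auto
      also have "\<dots> \<le> A 0 + (\<integral>\<^sup>+u\<in>{0..s}. ennreal (exp u) * (2 * A u) \<partial>lborel)"
        by (intro add_left_mono nn_integral_mono mult_right_mono mult_left_mono pair_le) auto
      also have "(\<integral>\<^sup>+u\<in>{0..s}. ennreal (exp u) * (2 * A u) \<partial>lborel)
          = (\<integral>\<^sup>+u. 2 * (ennreal (exp u) * A u * indicator {0..s} u) \<partial>lborel)"
        by (intro nn_integral_cong) (simp add: ac_simps)
      also have "\<dots> = ennreal 2 * (\<integral>\<^sup>+u\<in>{0..s}. ennreal (exp u) * A u \<partial>lborel)"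
        by (subst nn_integral_cmult) auto
      finally show "ennreal (exp s) * A s
          \<le> ennreal (exp 0) * A 0 + ennreal 2 * (\<integral>\<^sup>+u\<in>{0..s}. ennreal (exp u) * A u \<partial>lborel)"
        by simp
    qed (use t in \<open>auto simp: ennreal_mult_less_top of_nat_less_top\<close>)
    then have weighted: "ennreal (exp t) * A t \<le> 2 * A 0 * ennreal (exp (4 * t))" by simp
    have "A t \<le> ennreal (exp t) * A t"
      using t mult_right_mono[of 1 "ennreal (exp t)" "A t"] by simp
    also have "\<dots> \<le> 2 * A 0 * ennreal (exp (4 * t))" by (rule weighted)
    also have "\<dots> \<le> 2 * (\<integral>\<^sup>+x. \<phi> x \<partial>law 0) * ennreal (exp (4 * t))"
      unfolding A_def \<psi>_def by (intro nn_integral_mono mult_mono) auto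
    finally show ?thesis by (simp add: A_def)
  qed
  have "(SUP n. \<psi> n x) = \<phi> x" for x
  proof -
    have "(SUP n. \<psi> n x) = inf (\<phi> x) (SUP n. of_nat n)"
      unfolding \<psi>_def inf_min[symmetric] by (rule inf_SUP[symmetric])
    then show ?thesis by (simp add: ennreal_SUP_of_nat_eq_top)
  qed
  then have "(\<integral>\<^sup>+x. \<phi> x \<partial>law t) = (\<integral>\<^sup>+x. (SUP n. \<psi> n x) \<partial>law t)" by simp
  also have "\<dots> = (SUP n. \<integral>\<^sup>+x. \<psi> n x \<partial>law t)"
    by (intro nn_integral_monotone_convergence_SUP)
       (auto simp: \<psi>_def incseq_def le_fun_def intro: min.coboundedI2)
  finally show ?thesis using truncated by (simp add: SUP_le_iff)
qed

text \<open>When the midpoint average multiplies the \<open>\<phi>\<close>-moment by \<open>\<kappa>\<close>, the moment \<open>A\<close> satisfies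
  \<open>A' = (\<kappa> - 1) A\<close>. The hypothesis \<open>closed\<close> is required only at times of finite moment,
  since for the variance it is derived by integrating a real-valued expansion.\<close>

lemma moment_exponential:
  assumes \<phi>[measurable]: "\<phi> \<in> borel_measurable borel"
    and midpoint: "\<And>y z. \<phi> ((y + z) / 2) \<le> max (\<phi> y) (\<phi> z)"
    and finite: "(\<integral>\<^sup>+x. \<phi> x \<partial>law 0) < \<infinity>"
    and \<kappa>: "\<kappa> > 0"
    and closed: "\<And>s. s \<ge> 0 \<Longrightarrow> (\<integral>\<^sup>+x. \<phi> x \<partial>law s) < \<infinity> \<Longrightarrow>
      (\<integral>\<^sup>+y. \<integral>\<^sup>+z. \<phi> ((y + z) / 2) \<partial>law s \<partial>law s) = ennreal \<kappa> * (\<integral>\<^sup>+x. \<phi> x \<partial>law s)"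
    and t: "t \<ge> 0"
  shows "(\<integral>\<^sup>+x. \<phi> x \<partial>law t) = (\<integral>\<^sup>+x. \<phi> x \<partial>law 0) * ennreal (exp ((\<kappa> - 1) * t))"
proof -
  define A where "A = (\<lambda>s. \<integral>\<^sup>+x. \<phi> x \<partial>law s)"
  have [measurable]: "A \<in> borel_measurable borel" by (simp add: A_def)
  have A_le: "A s \<le> 2 * A 0 * ennreal (exp (4 * t))" if "s \<in> {0..t}" for s
  proof -
    have "A s \<le> 2 * A 0 * ennreal (exp (4 * s))"
      unfolding A_def using that by (intro moment_le midpoint) auto
    also have "\<dots> \<le> 2 * A 0 * ennreal (exp (4 * t))"
      using that by (intro mult_left_mono ennreal_leI) auto
    finally show ?thesis .
  qed
  have bound_finite: "2 * A 0 * ennreal (exp (4 * t)) < \<infinity>"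
    using finite by (auto simp: A_def ennreal_mult_less_top)
  have "ennreal (exp t) * A t = ennreal (exp 0) * A 0 * ennreal (exp (\<kappa> * t))"
  proof (rule linear_integral_equation[where g = "\<lambda>s. ennreal (exp s) * A s"
        and B = "ennreal (exp t) * (2 * A 0 * ennreal (exp (4 * t)))"])
    fix s assume s: "s \<in> {0..t}"
    show "ennreal (exp s) * A s \<le> ennreal (exp t) * (2 * A 0 * ennreal (exp (4 * t)))"
      using s A_le by (intro mult_mono ennreal_leI) auto
    have "ennreal (exp s) * A s = A 0 + (\<integral>\<^sup>+u\<in>{0..s}. ennreal (exp u) *
        (\<integral>\<^sup>+y. \<integral>\<^sup>+z. \<phi> ((y + z) / 2) \<partial>law u \<partial>law u) \<partial>lborel)"
      unfolding A_def using s by (intro moment_evolution) auto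
    also have "(\<integral>\<^sup>+u\<in>{0..s}. ennreal (exp u) *
        (\<integral>\<^sup>+y. \<integral>\<^sup>+z. \<phi> ((y + z) / 2) \<partial>law u \<partial>law u) \<partial>lborel)
        = (\<integral>\<^sup>+u. ennreal \<kappa> * (ennreal (exp u) * A u * indicator {0..s} u) \<partial>lborel)"
    proof (rule nn_integral_cong)
      fix u
      have "(\<integral>\<^sup>+y. \<integral>\<^sup>+z. \<phi> ((y + z) / 2) \<partial>law u \<partial>law u) = ennreal \<kappa> * A u" if "u \<in> {0..s}"
        unfolding A_def
      proof (rule closed)
        show "(\<integral>\<^sup>+x. \<phi> x \<partial>law u) < \<infinity>"
          using le_less_trans[OF A_le bound_finite] that s by (simp add: A_def)
      qed (use that in auto)
      then show "ennreal (exp u) * (\<integral>\<^sup>+y. \<integral>\<^sup>+z. \<phi> ((y + z) / 2) \<partial>law u \<partial>law u) * indicator {0..s} u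
          = ennreal \<kappa> * (ennreal (exp u) * A u * indicator {0..s} u)"
        by (auto simp: indicator_def ac_simps)
    qed
    also have "\<dots> = ennreal \<kappa> * (\<integral>\<^sup>+u\<in>{0..s}. ennreal (exp u) * A u \<partial>lborel)"
      by (rule nn_integral_cmult) measurable
    finally show "ennreal (exp s) * A s
        = ennreal (exp 0) * A 0 + ennreal \<kappa> * (\<integral>\<^sup>+u\<in>{0..s}. ennreal (exp u) * A u \<partial>lborel)"
      by simp
  next
    show "ennreal (exp t) * (2 * A 0 * ennreal (exp (4 * t))) < \<infinity>"
      using bound_finite by (simp add: ennreal_mult_less_top)
  qed (use t \<kappa> in auto)
  then have "ennreal (exp (- t)) * (ennreal (exp t) * A t)
      = A 0 * (ennreal (exp (\<kappa> * t)) * ennreal (exp (- t)))"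
    by (simp add: ac_simps)
  also have "ennreal (exp (\<kappa> * t)) * ennreal (exp (- t)) = ennreal (exp ((\<kappa> - 1) * t))"
    by (simp add: ennreal_mult[symmetric] exp_add[symmetric] algebra_simps)
  also have "ennreal (exp (- t)) * (ennreal (exp t) * A t) = A t"
    by (simp add: mult.assoc[symmetric] ennreal_mult[symmetric] exp_add[symmetric])
  finally show ?thesis by (simp add: A_def)
qed

end

section \<open>Mean and variance of a midpoint\<close>

lemma midpoint_first_moment:
  fixes M :: "real measure"
  assumes "prob_space M" and sets_eq[measurable_cong]: "sets M = sets borel"
    and nonneg: "AE x in M. 0 \<le> x"
  shows "(\<integral>\<^sup>+y. \<integral>\<^sup>+z. ennreal ((y + z) / 2) \<partial>M \<partial>M) = (\<integral>\<^sup>+x. ennreal x \<partial>M)"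
proof -
  interpret prob_space M by fact
  have "(\<integral>\<^sup>+y. \<integral>\<^sup>+z. ennreal ((y + z) / 2) \<partial>M \<partial>M)
      = (\<integral>\<^sup>+y. \<integral>\<^sup>+z. ennreal (1 / 2) * ennreal y + ennreal (1 / 2) * ennreal z \<partial>M \<partial>M)"
  proof (rule nn_integral_cong_AE, use nonneg in eventually_elim, rule nn_integral_cong_AE,
         use nonneg in eventually_elim)
    fix y z :: real assume "0 \<le> y" "0 \<le> z"
    then show "ennreal ((y + z) / 2) = ennreal (1 / 2) * ennreal y + ennreal (1 / 2) * ennreal z"
      by (simp add: add_divide_distrib ennreal_mult[symmetric] del: ennreal_half)
  qed
  also have "\<dots> = ennreal (1 / 2) * (\<integral>\<^sup>+x. ennreal x \<partial>M) + ennreal (1 / 2) * (\<integral>\<^sup>+x. ennreal x \<partial>M)"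
    by (simp add: nn_integral_add nn_integral_cmult emeasure_space_1 del: ennreal_half)
  also have "\<dots> = (ennreal (1 / 2) + ennreal (1 / 2)) * (\<integral>\<^sup>+x. ennreal x \<partial>M)"
    by (rule distrib_right[symmetric])
  also have "ennreal (1 / 2) + ennreal (1 / 2) = 1"
    by (simp del: ennreal_half flip: ennreal_plus)
  finally show ?thesis by simp
qed

text \<open>The variance of the mean of two independent samples is half the variance: in the expansion of
  \<open>((y - m) / 2 + (z - m) / 2)\<^sup>2\<close> the mixed term has mean zero.\<close>

lemma midpoint_variance:
  fixes M :: "real measure"
  assumes "prob_space M" and sets_eq[measurable_cong]: "sets M = sets borel"
    and mean: "has_bochner_integral M (\<lambda>x. x) m"
    and square: "integrable M (\<lambda>x. (x - m)\<^sup>2)"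
  shows "(\<integral>\<^sup>+y. \<integral>\<^sup>+z. ennreal (((y + z) / 2 - m)\<^sup>2) \<partial>M \<partial>M)
           = ennreal (1 / 2) * (\<integral>\<^sup>+x. ennreal ((x - m)\<^sup>2) \<partial>M)"
proof -
  interpret prob_space M by fact
  define v where "v = (\<integral>x. (x - m)\<^sup>2 \<partial>M)"
  have int: "integrable M (\<lambda>x. x)" "(\<integral>x. x \<partial>M) = m"
    using mean by (auto simp: has_bochner_integral_iff)
  have v: "(\<integral>\<^sup>+x. ennreal ((x - m)\<^sup>2) \<partial>M) = ennreal v"
    unfolding v_def using square by (intro nn_integral_eq_integral) auto
  have expand: "((y + z) / 2 - m)\<^sup>2 = (y - m)\<^sup>2 / 4 + (y - m) / 2 * (z - m) + (z - m)\<^sup>2 / 4"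
    for y z :: real
    by (simp add: power2_eq_square field_simps)
  have inner: "(\<integral>\<^sup>+z. ennreal (((y + z) / 2 - m)\<^sup>2) \<partial>M) = ennreal ((y - m)\<^sup>2 / 4 + v / 4)" for y
  proof -
    have "integrable M (\<lambda>z. ((y + z) / 2 - m)\<^sup>2)"
      unfolding expand using int square by auto
    then have "(\<integral>\<^sup>+z. ennreal (((y + z) / 2 - m)\<^sup>2) \<partial>M) = ennreal (\<integral>z. ((y + z) / 2 - m)\<^sup>2 \<partial>M)"
      by (intro nn_integral_eq_integral) auto
    also have "(\<integral>z. ((y + z) / 2 - m)\<^sup>2 \<partial>M) = (y - m)\<^sup>2 / 4 + v / 4"
      unfolding expand using int square by (simp add: prob_space v_def)
    finally show ?thesis .
  qed
  have "(\<integral>\<^sup>+y. ennreal ((y - m)\<^sup>2 / 4 + v / 4) \<partial>M) = ennreal (\<integral>y. (y - m)\<^sup>2 / 4 + v / 4 \<partial>M)"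
    using square by (intro nn_integral_eq_integral) (auto simp: v_def)
  also have "(\<integral>y. (y - m)\<^sup>2 / 4 + v / 4 \<partial>M) = 1 / 2 * v"
    using square by (simp add: prob_space v_def)
  also have "ennreal (1 / 2 * v) = ennreal (1 / 2) * ennreal v"
    by (rule ennreal_mult'') (simp add: v_def)
  finally show ?thesis unfolding inner v .
qed

section \<open>Classical solutions\<close>

text \<open>Freezing the profile at negative times, by \<open>max 0 s\<close>, turns continuity on \<open>[0, \<infinity>)\<close> into
  continuity on \<open>\<real>\<close> and keeps every profile a probability density.\<close>

lemma averaging_flow_of_classical_solution:
  assumes density: "\<And>t. t \<ge> 0 \<Longrightarrow> prob_density (\<rho> t)"
    and solution: "classical_solution \<rho>"
  shows "averaging_flow (\<lambda>s x. indicator {0..} x * \<rho> (max 0 s) x)"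
proof
  fix s x :: real
  let ?r = "\<lambda>s x. indicator {0..} x * \<rho> (max 0 s) x :: real"
  have pd: "prob_density (\<rho> (max 0 s))" by (rule density) simp
  show nonneg: "0 \<le> ?r s x" for s x
    using density[of "max 0 s"] by (auto simp: prob_density_def indicator_def)
  show "?r s x = 0" if "x < 0" using that by simp
  show meas: "?r s \<in> borel_measurable borel"
    using pd by (simp add: prob_density_def set_borel_measurable_def)
  interpret prob_space "halfline_law (\<rho> (max 0 s))" using pd by (simp add: prob_density_def)
  show "(\<integral>\<^sup>+x. ennreal (?r s x) \<partial>lborel) = 1"
    using emeasure_space_1 meas by (simp add: halfline_law_def emeasure_density)
  show "continuous_on UNIV (\<lambda>s. ?r s x)"
  proof (cases "x \<ge> 0")
    case True
    then have "continuous_on {0..} (\<lambda>t. \<rho> t x)" using solution by (simp add: classical_solution_def)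
    then have "continuous_on UNIV (\<lambda>s. \<rho> (max 0 s) x)"
      by (rule continuous_on_compose2) (auto intro!: continuous_intros)
    then show ?thesis by (intro continuous_intros)
  qed simp
  assume s: "0 < s" and x: "0 \<le> x"
  define f where "f = (\<lambda>y. \<rho> s y * \<rho> s (2 * x - y))"
  have int: "set_integrable lborel {0..2 * x} f"
    and deriv: "((\<lambda>s. \<rho> s x) has_real_derivative 2 * (LINT y:{0..2 * x}|lborel. f y) - \<rho> s x) (at s)"
    using solution s x by (auto simp: classical_solution_def f_def)
  have product: "?r s y * ?r s (2 * x - y) = indicator {0..2 * x} y * f y" for y
    using s by (auto simp: f_def indicator_def)
  have f_nonneg: "0 \<le> indicator {0..2 * x} y * f y" for y
    using nonneg[of y s] nonneg[of "2 * x - y" s] unfolding product[symmetric] by (rule mult_nonneg_nonneg)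
  let ?q = "2 * (LINT y:{0..2 * x}|lborel. f y)"
  show "\<exists>q\<ge>0. (\<integral>\<^sup>+y. ennreal (2 * (?r s y * ?r s (2 * x - y))) \<partial>lborel) = ennreal q \<and>
      ((\<lambda>s. ?r s x) has_real_derivative q - ?r s x) (at s)"
  proof (intro exI conjI)
    show "0 \<le> ?q"
      using f_nonneg by (auto simp: set_lebesgue_integral_def intro!: integral_nonneg)
    have "(\<integral>\<^sup>+y. ennreal (2 * (indicator {0..2 * x} y * f y)) \<partial>lborel)
        = ennreal (\<integral>y. 2 * (indicator {0..2 * x} y * f y) \<partial>lborel)"
      using int f_nonneg by (intro nn_integral_eq_integral) (auto simp: set_integrable_def)
    then show "(\<integral>\<^sup>+y. ennreal (2 * (?r s y * ?r s (2 * x - y))) \<partial>lborel) = ennreal ?q"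
      unfolding product by (simp add: set_lebesgue_integral_def)
    show "((\<lambda>s. ?r s x) has_real_derivative ?q - ?r s x) (at s)"
    proof (rule has_field_derivative_transform_within_open[where S = "{0<..}"])
      show "((\<lambda>s. \<rho> s x) has_real_derivative ?q - ?r s x) (at s)" using deriv s x by simp
    qed (use s x in auto)
  qed
qed

theorem theorem1:
  fixes \<rho> :: "real \<Rightarrow> real \<Rightarrow> real" and \<mu> :: real
  assumes density: "\<And>t. t \<ge> 0 \<Longrightarrow> prob_density (\<rho> t)"
    and solution: "classical_solution \<rho>"
    and mean: "has_mean (\<rho> 0) \<mu>"
    and mean_pos: "\<mu> > 0"
    and variance: "finite_variance (\<rho> 0)"
  shows "\<forall>t\<ge>0. finite_variance (\<rho> t) \<and>
           density_variance (\<rho> t) = density_variance (\<rho> 0) * exp (- t / 2)"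
proof -
  interpret averaging_flow "\<lambda>s x. indicator {0..} x * \<rho> (max 0 s) x"
    using density solution by (rule averaging_flow_of_classical_solution)
  have law: "law t = halfline_law (\<rho> t)" if "t \<ge> 0" for t
    using that by (simp add: law_def halfline_law_def max_absorb2)
  have mean_at: "has_bochner_integral (law t) (\<lambda>x. x) \<mu>" if t: "t \<ge> 0" for t
  proof -
    have mean_0: "(\<integral>\<^sup>+x. ennreal x \<partial>law 0) = ennreal \<mu>"
      using mean AE_law_nonneg[of 0] unfolding has_mean_def law[OF order_refl, symmetric]
      by (subst nn_integral_eq_integral) (auto simp: has_bochner_integral_iff)
    have "(\<integral>\<^sup>+x. ennreal x \<partial>law t) = (\<integral>\<^sup>+x. ennreal x \<partial>law 0) * ennreal (exp ((1 - 1) * t))"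
    proof (rule moment_exponential[OF _ _ _ _ _ t])
      show "ennreal ((y + z) / 2) \<le> max (ennreal y) (ennreal z)" for y z
        unfolding ennreal_max[symmetric] by (rule ennreal_leI) simp
      show "(\<integral>\<^sup>+y. \<integral>\<^sup>+z. ennreal ((y + z) / 2) \<partial>law s \<partial>law s) = ennreal 1 * (\<integral>\<^sup>+x. ennreal x \<partial>law s)" for s
        using midpoint_first_moment[OF prob_space_law sets_law AE_law_nonneg] by simp
    qed (use mean_0 in auto)
    with mean_0 show ?thesis
      using mean_pos AE_law_nonneg by (intro has_bochner_integral_nn_integral) auto
  qed
  have average_le_max: "(a + b) / 2 \<le> max a b" for a b :: real
    by (simp add: max_def)
  have square_0: "integrable (law 0) (\<lambda>x. (x - \<mu>)\<^sup>2)"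
  proof -
    \<comment> \<open>The centre in the definition of finite variance is some mean, and the mean is unique.\<close>
    obtain m where "has_mean (\<rho> 0) m" "integrable (halfline_law (\<rho> 0)) (\<lambda>x. (x - m)\<^sup>2)"
      using variance by (auto simp: finite_variance_def)
    moreover from this mean have "m = \<mu>"
      unfolding has_mean_def by (auto dest: has_bochner_integral_eq)
    ultimately show ?thesis by (simp add: law)
  qed
  have variance_eq: "density_variance (\<rho> t) = (\<integral>x. (x - \<mu>)\<^sup>2 \<partial>law t)" if "t \<ge> 0" for t
    using mean_at[OF that] that
    by (simp add: density_variance_def law has_bochner_integral_iff)
  have v0: "(\<integral>\<^sup>+x. ennreal ((x - \<mu>)\<^sup>2) \<partial>law 0) = ennreal (density_variance (\<rho> 0))"
    unfolding variance_eq[OF order_refl] using square_0 by (intro nn_integral_eq_integral) auto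
  have v0_nonneg: "density_variance (\<rho> 0) \<ge> 0" by (simp add: variance_eq)
  show ?thesis
  proof (intro allI impI)
    fix t :: real assume t: "t \<ge> 0"
    have "(\<integral>\<^sup>+x. ennreal ((x - \<mu>)\<^sup>2) \<partial>law t)
        = (\<integral>\<^sup>+x. ennreal ((x - \<mu>)\<^sup>2) \<partial>law 0) * ennreal (exp ((1 / 2 - 1) * t))"
    proof (rule moment_exponential[OF _ _ _ _ _ t])
      show "ennreal (((y + z) / 2 - \<mu>)\<^sup>2) \<le> max (ennreal ((y - \<mu>)\<^sup>2)) (ennreal ((z - \<mu>)\<^sup>2))" for y z
      proof -
        have "((y + z) / 2 - \<mu>)\<^sup>2 = ((y - \<mu>)\<^sup>2 + (z - \<mu>)\<^sup>2) / 2 - ((y - z) / 2)\<^sup>2"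
          by (simp add: power2_eq_square field_simps)
        also have "\<dots> \<le> ((y - \<mu>)\<^sup>2 + (z - \<mu>)\<^sup>2) / 2"
          using zero_le_power2[of "(y - z) / 2"] by linarith
        also have "\<dots> \<le> max ((y - \<mu>)\<^sup>2) ((z - \<mu>)\<^sup>2)" by (rule average_le_max)
        finally show ?thesis unfolding ennreal_max[symmetric] by (rule ennreal_leI)
      qed
      fix s :: real assume s: "s \<ge> 0" "(\<integral>\<^sup>+x. ennreal ((x - \<mu>)\<^sup>2) \<partial>law s) < \<infinity>"
      then have "integrable (law s) (\<lambda>x. (x - \<mu>)\<^sup>2)" by (intro integrableI_nonneg) auto
      then show "(\<integral>\<^sup>+y. \<integral>\<^sup>+z. ennreal (((y + z) / 2 - \<mu>)\<^sup>2) \<partial>law s \<partial>law s)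
          = ennreal (1 / 2) * (\<integral>\<^sup>+x. ennreal ((x - \<mu>)\<^sup>2) \<partial>law s)"
        by (intro midpoint_variance[OF prob_space_law sets_law mean_at[OF s(1)]])
    qed (use v0 in auto)
    also have "\<dots> = ennreal (density_variance (\<rho> 0) * exp (- t / 2))"
      unfolding v0 using v0_nonneg by (simp add: ennreal_mult)
    finally have "has_bochner_integral (law t) (\<lambda>x. (x - \<mu>)\<^sup>2) (density_variance (\<rho> 0) * exp (- t / 2))"
      using v0_nonneg by (intro has_bochner_integral_nn_integral) auto
    then show "finite_variance (\<rho> t) \<and>
        density_variance (\<rho> t) = density_variance (\<rho> 0) * exp (- t / 2)"
      using mean_at[OF t] variance_eq[OF t]
      by (auto simp: finite_variance_def has_mean_def law[OF t, symmetric] has_bochner_integral_iff)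
  qed
qed

end
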